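(* Let $G$ be a finite soluble non-nilpotent group. Then $G\in\mathfrak{Y}_n$ if and only if $G$ splits as a semidirect product $G=\langle x\rangle\ltimes A$, where $\langle x\rangle$ is a $p$-group for some prime $p$, $A$ is an abelian $p'$-group, $x^p$ is central in $G$, and $x$ acts fixed point freely on $A$.
   Context: $\mathfrak{Y}_n$ denotes the class of all groups $G$ such that $N_G(A)=A$ for every non-abelian subgroup $A\le G$. A $p'$-group is a group whose order is coprime to $p$. "$x$ acts fixed point freely on $A$" means the only $a\in A$ with $a^x=a$ is the identity. *)

theory Defs
  imports "HOL-Algebra.Algebra"
begin

definition commutator_subgroup :: "('a, 'b) monoid_scheme \<Rightarrow> 'a set \<Rightarrow> 'a set \<Rightarrow> 'a set" where
  "commutator_subgroup G H K =
     generate G {h \<otimes>\<^bsub>G\<^esub> k \<otimes>\<^bsub>G\<^esub> inv\<^bsub>G\<^esub> h \<otimes>\<^bsub>G\<^esub> inv\<^bsub>G\<^esub> k | h k. h \<in> H \<and> k \<in> K}"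

text \<open>Lower central series: gamma_1 = G, gamma_{i+1} = [gamma_i, G] (indexed from 0 here).\<close>
primrec lower_central :: "('a, 'b) monoid_scheme \<Rightarrow> nat \<Rightarrow> 'a set" where
  "lower_central G 0 = carrier G"
| "lower_central G (Suc n) = commutator_subgroup G (lower_central G n) (carrier G)"

definition nilpotent :: "('a, 'b) monoid_scheme \<Rightarrow> bool" where
  "nilpotent G \<longleftrightarrow> (\<exists>n. lower_central G n = {\<one>\<^bsub>G\<^esub>})"

definition center :: "('a, 'b) monoid_scheme \<Rightarrow> 'a set" where
  "center G = {z \<in> carrier G. \<forall>g \<in> carrier G. z \<otimes>\<^bsub>G\<^esub> g = g \<otimes>\<^bsub>G\<^esub> z}"

definition abelian_set :: "('a, 'b) monoid_scheme \<Rightarrow> 'a set \<Rightarrow> bool" where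
  "abelian_set G A \<longleftrightarrow> (\<forall>a \<in> A. \<forall>b \<in> A. a \<otimes>\<^bsub>G\<^esub> b = b \<otimes>\<^bsub>G\<^esub> a)"

definition Yn :: "('a, 'b) monoid_scheme \<Rightarrow> bool" where
  "Yn G \<longleftrightarrow> (\<forall>A. subgroup A G \<and> \<not> abelian_set G A \<longrightarrow> normalizer G A = A)"

end

theory Submission
  imports Defs "HOL-Number_Theory.Cong"
begin

text \<open>
  Let \<open>M\<close> be a maximal subgroup containing the derived subgroup. It is normal, hence abelian if
  every non-abelian subgroup is self-normalizing, and \<open>G = M\<langle>y\<rangle>\<close> with \<open>y\<close> of \<open>p\<close>-power order and
  \<open>y\<^sup>p \<in> M\<close>. The map \<open>\<phi> m = [y, m]\<close> is an endomorphism of \<open>M\<close>, and the lower central series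
  lies in its iterated images, so their stable value \<open>A\<close> is nontrivial. As \<open>\<phi>\<close> is bijective on \<open>A\<close>,
  \<open>y\<close> acts on \<open>A\<close> without fixed points, so \<open>\<langle>y\<rangle>A\<close> is non-abelian, and self-normalization of
  \<open>\<langle>y\<rangle>A\<close> forces \<open>M \<subseteq> \<langle>y\<rangle>A\<close>. Counting fixed points gives \<open>|A| \<equiv> 1\<close> modulo \<open>p\<close>.

  Conversely, a non-abelian subgroup \<open>H\<close> contains some \<open>w = xc\<close> with \<open>c \<in> A\<close>, and \<open>a \<mapsto> [w, a]\<close> is
  injective on \<open>A\<close>, hence bijective on \<open>H \<inter> A\<close>. For \<open>a \<in> A\<close> normalizing \<open>H\<close>, \<open>[w, a]\<close> lies in
  \<open>H \<inter> A\<close>, so \<open>a \<in> H\<close>.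
\<close>

section \<open>Counting fixed points of a map whose \<open>p\<close>-th iterate is the
  identity\<close>

lemma funpow_fixed_mult:
  assumes "(f ^^ n) x = x"
  shows "(f ^^ (n * k)) x = x"
  using assms by (induction k) (simp_all add: funpow_add)

text \<open>Bezout in the form \<open>m * u = n * v + 1\<close> keeps all exponents natural, so
  \<open>f\<close> need not be invertible: the \<open>n * v + 1\<close>-st iterate fixes
  \<open>x\<close>, and so does the \<open>n * v\<close>-th.\<close>

lemma funpow_fixed_coprime:
  assumes "(f ^^ m) x = x" "(f ^^ n) x = x" "coprime m n" "m \<noteq> 0"
  shows "f x = x"
proof -
  obtain u v where "m * u = n * v + 1"
    using bezout_nat[OF assms(4), of n] assms(3) by auto
  then have "f ((f ^^ (n * v)) x) = (f ^^ (m * u)) x"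
    by simp
  then show ?thesis
    using funpow_fixed_mult assms(1,2) by metis
qed

text \<open>The points that \<open>f\<close> moves split into disjoint orbits of exactly
  \<open>p\<close> elements each, so their number is divisible by \<open>p\<close>.\<close>

lemma card_fixed_points_cong:
  fixes p :: nat
  assumes "finite S" and S: "\<And>x. x \<in> S \<Longrightarrow> f x \<in> S"
    and p: "Factorial_Ring.prime p" and id: "\<And>x. x \<in> S \<Longrightarrow> (f ^^ p) x = x"
  shows "[card S = card {x \<in> S. f x = x}] (mod p)"
proof -
  let ?F = "{x \<in> S. f x = x}"
  define orb where "orb x = (\<lambda>i. (f ^^ i) x) ` {..<p}" for x
  have fS: "(f ^^ i) x \<in> S" if "x \<in> S" for i x
    using that S by (induction i) auto
  have p0: "p > 0" using p by (simp add: prime_gt_0_nat)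
  \<comment> \<open>The bound on the exponent in \<open>orb\<close> serves to count elements;
    reducing exponents modulo \<open>p\<close> removes it when closure under \<open>f\<close> is
    needed.\<close>
  have orb_iff: "orb x = {(f ^^ i) x | i. True}" if "x \<in> S" for x
  proof -
    have "(f ^^ i) x = (f ^^ (i mod p)) x" for i
      using funpow_mod_eq[OF id[OF that]] by metis
    then show ?thesis unfolding orb_def using p0
      by (auto intro!: rev_image_eqI[where x = "_ mod p"])
  qed
  \<comment> \<open>Orbits are symmetric because the \<open>(p - i)\<close>-th iterate undoes the
    \<open>i\<close>-th one.\<close>
  have ret: "x \<in> orb z" if z: "z \<in> orb x" and x: "x \<in> S" for x z
  proof -
    obtain i where i: "i < p" "z = (f ^^ i) x" using z by (auto simp: orb_def)
    have "(f ^^ (p - i)) z = x"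
      using i id[OF x] by (metis funpow_add comp_apply le_add_diff_inverse2 less_imp_le)
    moreover have "z \<in> S" using i fS x by simp
    ultimately show ?thesis using orb_iff by blast
  qed
  have tra: "orb z \<subseteq> orb x" if z: "z \<in> orb x" and x: "x \<in> S" for x z
  proof -
    obtain i where i: "z = (f ^^ i) x" using z by (auto simp: orb_def)
    have zS: "z \<in> S" using i fS x by simp
    have "(f ^^ j) z = (f ^^ (j + i)) x" for j using i by (simp add: funpow_add)
    then show ?thesis unfolding orb_iff[OF zS] orb_iff[OF x] by blast
  qed
  have same: "orb z = orb x" if "z \<in> orb x" "x \<in> S" for x z
  proof -
    have "z \<in> S" using that fS by (auto simp: orb_def)
    then show ?thesis using tra ret that by blast
  qed
  have self: "x \<in> orb x" if "x \<in> S" for x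
    unfolding orb_iff[OF that] by (rule CollectI, rule exI[of _ 0]) simp
  have card_orb: "card (orb x) = p" if x: "x \<in> S" "f x \<noteq> x" for x
  proof -
    \<comment> \<open>A repetition at \<open>i < j\<close> would make the \<open>(j - i)\<close>-th
      iterate fix \<open>x\<close>; as \<open>0 < j - i < p\<close>, this exponent is coprime to
      \<open>p\<close>, and \<open>f\<close> itself would fix \<open>x\<close>.\<close>
    have inj_aux: False if ij: "i < j" "j < p" "(f ^^ i) x = (f ^^ j) x" for i j
    proof -
      have "(f ^^ (p - i)) ((f ^^ j) x) = (f ^^ (p - i)) ((f ^^ i) x)" using ij by simp
      also have "\<dots> = x"
        using ij id[OF x(1)] by (metis funpow_add comp_apply le_add_diff_inverse2 less_imp_le less_trans)
      finally have "(f ^^ ((p - i) + j)) x = x" by (simp add: funpow_add)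
      moreover have "p - i + j = (j - i) + p" using ij by simp
      ultimately have "(f ^^ (j - i)) x = x"
        using id[OF x(1)] by (simp add: funpow_add)
      moreover have "coprime (j - i) p"
        using ij p by (metis coprime_commute diff_is_0_eq dvd_imp_le leD less_imp_diff_less
            not_gr_zero prime_imp_coprime)
      ultimately have "f x = x"
        using funpow_fixed_coprime[of "j - i" f x p] id[OF x(1)] ij by simp
      then show False using x by simp
    qed
    have "inj_on (\<lambda>i. (f ^^ i) x) {..<p}"
    proof (rule inj_onI)
      fix i j assume "i \<in> {..<p}" "j \<in> {..<p}" "(f ^^ i) x = (f ^^ j) x"
      then show "i = j" using inj_aux[of i j] inj_aux[of j i] by (cases i j rule: linorder_cases) auto
    qed
    then show ?thesis unfolding orb_def by (simp add: card_image)
  qed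
  let ?N = "{x \<in> S. f x \<noteq> x}"
  have sub: "orb x \<subseteq> ?N" if x: "x \<in> ?N" for x
  proof
    fix z assume z: "z \<in> orb x"
    have zS: "z \<in> S" using z x fS by (auto simp: orb_def)
    have "f z \<noteq> z"
    proof
      assume fz: "f z = z"
      have "(f ^^ i) z = z" for i by (induction i) (auto simp: fz)
      then have "orb z = {z}" using orb_iff[OF zS] by auto
      then have "x = z" using ret z x by auto
      then show False using fz x by simp
    qed
    then show "z \<in> ?N" using zS by simp
  qed
  have UN: "\<Union> (orb ` ?N) = ?N" using sub self by blast
  have "p dvd card (\<Union> (orb ` ?N))"
  proof (rule dvd_partition)
    show "finite (\<Union> (orb ` ?N))" unfolding UN using assms(1) by simp
    show "\<forall>c\<in>orb ` ?N. p dvd card c" using card_orb by auto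
    show "\<forall>c1\<in>orb ` ?N. \<forall>c2\<in>orb ` ?N. c1 \<noteq> c2 \<longrightarrow> c1 \<inter> c2 = {}"
      using same by blast
  qed
  moreover have "card S = card ?F + card ?N"
  proof -
    have "S = ?F \<union> ?N" by auto
    then show ?thesis using assms(1)
      by (metis (no_types, lifting) card_Un_disjoint disjoint_iff finite_Un mem_Collect_eq)
  qed
  ultimately show ?thesis
    unfolding UN by (simp add: cong_def mod_add_right_eq[symmetric])
qed

section \<open>Conjugation, normalizers, and elements outside a proper subgroup\<close>

context group
begin

lemma conj_eq_iff:
  assumes "x \<in> carrier G" "a \<in> carrier G" "b \<in> carrier G"
  shows "x \<otimes> a \<otimes> inv x = b \<longleftrightarrow> x \<otimes> a = b \<otimes> x"
  using assms by (metis inv_closed inv_solve_right m_closed)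

lemma mult_inv_cancel:
  assumes "x \<in> carrier G" "b \<in> carrier G"
  shows "x \<otimes> (inv x \<otimes> b) = b" "inv x \<otimes> (x \<otimes> b) = b"
  using assms by (simp_all flip: m_assoc)

lemma conj_mult:
  assumes "x \<in> carrier G" "a \<in> carrier G" "b \<in> carrier G"
  shows "x \<otimes> (a \<otimes> b) \<otimes> inv x = (x \<otimes> a \<otimes> inv x) \<otimes> (x \<otimes> b \<otimes> inv x)"
  using assms by (simp add: m_assoc mult_inv_cancel)

lemma conj_conj:
  assumes "x \<in> carrier G" "y \<in> carrier G" "a \<in> carrier G"
  shows "x \<otimes> (y \<otimes> a \<otimes> inv y) \<otimes> inv x = (x \<otimes> y) \<otimes> a \<otimes> inv (x \<otimes> y)"
  using assms by (simp add: m_assoc inv_mult_group)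

lemma conj_funpow:
  assumes "x \<in> carrier G" "a \<in> carrier G"
  shows "((\<lambda>a. x \<otimes> a \<otimes> inv x) ^^ n) a = x [^] n \<otimes> a \<otimes> inv (x [^] n)"
proof (induction n)
  case (Suc n)
  then show ?case unfolding nat_pow_Suc2[OF assms(1)] using assms by (simp add: conj_conj)
qed (use assms in simp)

lemma subgroup_nat_pow_closed:
  assumes "subgroup H G" "h \<in> H"
  shows "h [^] (n::nat) \<in> H"
  using subgroup_int_pow_closed[OF assms, of "int n"] by (simp add: int_pow_int)

lemma mem_subgroup_if_coprime_pows:
  fixes m n :: nat
  assumes H: "subgroup H G" and x: "x \<in> carrier G" and pows: "x [^] m \<in> H" "x [^] n \<in> H"
    and "coprime m n" "m \<noteq> 0"
  shows "x \<in> H"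
proof -
  obtain u v where uv: "m * u = n * v + 1"
    using bezout_nat[OF \<open>m \<noteq> 0\<close>, of n] \<open>coprime m n\<close> by auto
  have "x [^] (m * u) \<in> H" "x [^] (n * v) \<in> H"
    using pows subgroup_nat_pow_closed[OF H] x by (metis nat_pow_pow)+
  moreover have "x = inv (x [^] (n * v)) \<otimes> x [^] (m * u)"
    unfolding uv using x by (simp add: mult_inv_cancel)
  ultimately show ?thesis
    using H by (metis subgroup.m_closed subgroup.m_inv_closed)
qed

text \<open>Conjugation is injective, so on a finite \<open>H\<close> the inclusion of the conjugate
  in \<open>H\<close> is already the equality that \<open>normalizer\<close> demands.\<close>

lemma normalizerI:
  assumes H: "subgroup H G" and fin: "finite H" and g: "g \<in> carrier G"
    and conj: "\<And>h. h \<in> H \<Longrightarrow> g \<otimes> h \<otimes> inv g \<in> H"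
  shows "g \<in> normalizer G H"
proof -
  have HG: "H \<subseteq> carrier G" using H by (rule subgroup.subset)
  have eq: "g <# H #> inv g = (\<lambda>h. g \<otimes> h \<otimes> inv g) ` H"
    unfolding l_coset_def r_coset_def by auto
  have "inj_on (\<lambda>h. g \<otimes> h \<otimes> inv g) H"
    using HG g by (intro inj_onI) (metis inv_closed m_closed r_cancel l_cancel subsetD)
  then have "(\<lambda>h. g \<otimes> h \<otimes> inv g) ` H = H"
    using conj fin by (intro endo_inj_surj) auto
  then show ?thesis
    using eq HG g unfolding normalizer_def stabilizer_def by simp
qed

lemma normalizerD:
  assumes H: "subgroup H G" and g: "g \<in> normalizer G H" and h: "h \<in> H"
  shows "g \<in> carrier G" "g \<otimes> h \<otimes> inv g \<in> H"
proof -
  have HG: "H \<subseteq> carrier G" using H by (rule subgroup.subset)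
  have *: "g \<in> carrier G" "g <# H #> inv g = H"
    using g HG unfolding normalizer_def stabilizer_def by auto
  then show "g \<in> carrier G" "g \<otimes> h \<otimes> inv g \<in> H"
    using h unfolding l_coset_def r_coset_def by blast+
qed

lemma subset_normalizer:
  assumes "subgroup H G"
  shows "H \<subseteq> normalizer G H"
  using subgroup_in_normalizer[OF assms] normal_imp_subgroup subgroup.subset by fastforce

text \<open>A conjugate of \<open>h\<close> is \<open>[g, h]\<close> times \<open>h\<close>, and
  both factors lie in \<open>M\<close>.\<close>

lemma normal_if_derived_subset:
  assumes M: "subgroup M G" and der: "derived G (carrier G) \<subseteq> M"
  shows "M \<lhd> G"
proof (unfold normal_inv_iff, intro conjI ballI)
  show "subgroup M G" by fact
  fix g h assume g: "g \<in> carrier G" and h: "h \<in> M"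
  have hG: "h \<in> carrier G" using h M subgroup.mem_carrier by metis
  have "g \<otimes> h \<otimes> inv g \<otimes> inv h \<in> derived G (carrier G)"
    unfolding derived_def using g hG by (intro generate.incl) blast
  then have "g \<otimes> h \<otimes> inv g \<otimes> inv h \<otimes> h \<in> M"
    using der h subgroup.m_closed[OF M] by blast
  then show "g \<otimes> h \<otimes> inv g \<in> M" using g hG by (simp add: m_assoc)
qed

text \<open>Otherwise the derived series would be constant and never reach the trivial
  subgroup.\<close>

lemma solvable_derived_proper:
  assumes "solvable G" "carrier G \<noteq> {\<one>}"
  shows "derived G (carrier G) \<noteq> carrier G"
proof
  assume der: "derived G (carrier G) = carrier G"
  have "(derived G ^^ n) (carrier G) = carrier G" for n
    by (induction n) (auto simp: der)
  then show False using assms unfolding solvable_def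
    by (auto dest: solvable_imp_trivial_derived_seq)
qed

lemma ex_maximal_subgroup_above:
  assumes fin: "finite (carrier G)" and K: "subgroup K G" "K \<noteq> carrier G"
  obtains M where "subgroup M G" "M \<noteq> carrier G" "K \<subseteq> M"
    "\<And>H. subgroup H G \<Longrightarrow> M \<subset> H \<Longrightarrow> H = carrier G"
proof -
  let ?S = "{H. subgroup H G \<and> H \<noteq> carrier G}"
  have "?S \<subseteq> Pow (carrier G)" using subgroup.subset by blast
  then have "finite ?S" using fin finite_subset by blast
  then obtain M where M: "M \<in> ?S" "K \<subseteq> M" "\<forall>H\<in>?S. M \<subseteq> H \<longrightarrow> M = H"
    using finite_has_maximal2[of ?S K] K by auto
  show ?thesis
  proof (rule that)
    show "subgroup M G" "M \<noteq> carrier G" "K \<subseteq> M" using M by auto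
    show "H = carrier G" if "subgroup H G" "M \<subset> H" for H using M(3) that by blast
  qed
qed

text \<open>Take \<open>z\<close> outside \<open>M\<close>, the least \<open>d > 0\<close> with
  \<open>z^d\<close> in \<open>M\<close>, and a prime \<open>p\<close> dividing \<open>d\<close>. By
  minimality \<open>x = z^(d/p)\<close> is outside \<open>M\<close>, while \<open>x^p\<close> is
  inside. A suitable power of \<open>x\<close> then has \<open>p\<close>-power order.\<close>

lemma ex_primepow_order_outside:
  assumes fin: "finite (carrier G)" and M: "subgroup M G" "M \<noteq> carrier G"
  obtains p :: nat and k y where "Factorial_Ring.prime p" "y \<in> carrier G" "y \<notin> M" "y [^] p \<in> M"
    "ord y = p ^ k"
proof -
  have oneM: "\<one> \<in> M" using M(1) by (rule subgroup.one_closed)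
  obtain z where z: "z \<in> carrier G" "z \<notin> M"
    using M subgroup.subset by blast
  define d where "d = (LEAST d::nat. d > 0 \<and> z [^] d \<in> M)"
  have "\<exists>d::nat. d > 0 \<and> z [^] d \<in> M"
    using z oneM fin ord_ge_1[of z] by (intro exI[of _ "ord z"]) auto
  then have d: "d > 0" "z [^] d \<in> M" unfolding d_def by (rule LeastI2_ex, blast)+
  have "d \<noteq> 1" using d z by auto
  then obtain p where p: "Factorial_Ring.prime p" "p dvd d"
    using prime_factor_nat by blast
  obtain e where e: "d = e * p" using p(2) by (metis dvd_def mult.commute)
  define x where "x = z [^] e"
  have x: "x \<in> carrier G" "x [^] p \<in> M"
    using z d e by (auto simp: x_def nat_pow_pow)
  have "e > 0" using d e by (cases e) auto
  moreover have "e < d" using e \<open>e > 0\<close> prime_gt_1_nat[OF p(1)] by simp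
  ultimately have xM: "x \<notin> M" unfolding x_def d_def using not_less_Least by blast
  have "ord x \<noteq> 0" using ord_ge_1[OF fin x(1)] by simp
  moreover have "\<not> is_unit p" using p(1) not_prime_unit by blast
  ultimately obtain m where m: "ord x = p ^ multiplicity p (ord x) * m" "\<not> p dvd m"
    using multiplicity_decompose'[of "ord x" p] by blast
  \<comment> \<open>Raising to the \<open>p'\<close>-part \<open>m\<close> of the order leaves only
    the \<open>p\<close>-part. The result stays outside \<open>M\<close>: otherwise
    \<open>x^m\<close> and \<open>x^p\<close>, with coprime exponents, would put \<open>x\<close> in
    \<open>M\<close>.\<close>
  let ?y = "x [^] m"
  have m0: "m \<noteq> 0" using m by (metis dvd_0_right)
  have cop: "coprime m p" using m p prime_imp_coprime coprime_commute by blast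
  have yM: "?y \<notin> M"
    using mem_subgroup_if_coprime_pows[OF M(1) x(1) _ x(2) cop m0] xM by blast
  have "?y [^] (p ^ multiplicity p (ord x)) = \<one>"
    using x m by (metis mult.commute nat_pow_pow pow_ord_eq_1)
  then have "ord ?y dvd p ^ multiplicity p (ord x)" using x by (simp add: pow_eq_id)
  then obtain k where "ord ?y = p ^ k" using p(1) divides_primepow_nat by blast
  moreover have "?y [^] p = (x [^] p) [^] m" using x by (simp add: nat_pow_pow mult.commute)
  then have "?y [^] p \<in> M" using x subgroup_nat_pow_closed[OF M(1)] by simp
  ultimately show ?thesis using that[OF p(1) _ yM] x by simp
qed

end

section \<open>The endomorphism \<open>m \<mapsto> [y, m]\<close> of an abelian normal
  subgroup\<close>

locale abelian_normal_conj = normal M G for M and G (structure) +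
  fixes y
  assumes finite_carrier: "finite (carrier G)"
    and abelian: "abelian_set G M"
    and y_closed [simp, intro]: "y \<in> carrier G"
begin

definition \<phi> where "\<phi> m = y \<otimes> m \<otimes> inv y \<otimes> inv m"

lemma M_comm: "a \<in> M \<Longrightarrow> b \<in> M \<Longrightarrow> a \<otimes> b = b \<otimes> a"
  using abelian by (simp add: abelian_set_def)

lemma finite_M: "finite M"
  using finite_carrier finite_subset subset by blast

lemma phi_closed [simp]: "a \<in> M \<Longrightarrow> \<phi> a \<in> M"
  unfolding \<phi>_def using inv_op_closed2 by auto

text \<open>Normality keeps the conjugates in \<open>M\<close>, and commutativity of
  \<open>M\<close> moves \<open>inv a\<close> past \<open>[y, b]\<close>.\<close>

lemma phi_mult:
  assumes "a \<in> M" "b \<in> M"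
  shows "\<phi> (a \<otimes> b) = \<phi> a \<otimes> \<phi> b"
proof -
  let ?c = "\<lambda>a. y \<otimes> a \<otimes> inv y"
  have c: "?c a \<in> M" "?c b \<in> M" using assms inv_op_closed2 by auto
  have "\<phi> (a \<otimes> b) = ?c a \<otimes> ?c b \<otimes> (inv b \<otimes> inv a)"
    unfolding \<phi>_def using assms by (simp add: conj_mult inv_mult_group)
  also have "\<dots> = ?c a \<otimes> ((?c b \<otimes> inv b) \<otimes> inv a)"
    using assms c by (simp add: m_assoc)
  also have "\<dots> = ?c a \<otimes> (inv a \<otimes> (?c b \<otimes> inv b))"
    using assms c M_comm[of "?c b \<otimes> inv b" "inv a"] by simp
  also have "\<dots> = \<phi> a \<otimes> \<phi> b"
    unfolding \<phi>_def using assms c by (simp add: m_assoc)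
  finally show ?thesis .
qed

lemma phi_one [simp]: "\<phi> \<one> = \<one>"
  by (simp add: \<phi>_def)

lemma phi_inv: "a \<in> M \<Longrightarrow> \<phi> (inv a) = inv (\<phi> a)"
  using phi_mult[of "inv a" a] by (simp add: inv_equality)

lemma conj_eq_phi: "a \<in> M \<Longrightarrow> y \<otimes> a \<otimes> inv y = \<phi> a \<otimes> a"
  unfolding \<phi>_def by (simp add: m_assoc)

lemma phi_eq_one_iff: "a \<in> M \<Longrightarrow> \<phi> a = \<one> \<longleftrightarrow> y \<otimes> a \<otimes> inv y = a"
  unfolding \<phi>_def using inv_equality inv_solve_right' by fastforce

lemma phi_inj_onI:
  assumes B: "subgroup B G" "B \<subseteq> M" and ker: "\<And>b. b \<in> B \<Longrightarrow> \<phi> b = \<one> \<Longrightarrow> b = \<one>"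
  shows "inj_on \<phi> B"
proof (rule inj_onI)
  fix a b assume ab: "a \<in> B" "b \<in> B" "\<phi> a = \<phi> b"
  have M: "a \<in> M" "b \<in> M" using ab B by auto
  have "\<phi> (a \<otimes> inv b) = \<one>" using M ab by (simp add: phi_mult phi_inv)
  then have "a \<otimes> inv b = \<one>"
    using ker ab B(1) by (simp add: subgroup.m_closed subgroup.m_inv_closed)
  then show "a = b" using M by (metis inv_closed inv_equality inv_inv mem_carrier)
qed

lemma subgroup_phi_image:
  assumes B: "subgroup B G" "B \<subseteq> M"
  shows "subgroup (\<phi> ` B) G"
proof (rule subgroupI)
  show "\<phi> ` B \<subseteq> carrier G" using B by auto
  show "\<phi> ` B \<noteq> {}" using subgroup.one_closed[OF B(1)] by auto
next
  fix a assume "a \<in> \<phi> ` B"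
  then obtain b where b: "b \<in> B" "a = \<phi> b" by blast
  then have "inv a = \<phi> (inv b)" using B phi_inv by auto
  then show "inv a \<in> \<phi> ` B"
    using b subgroup.m_inv_closed[OF B(1)] by blast
next
  fix a b assume "a \<in> \<phi> ` B" "b \<in> \<phi> ` B"
  then obtain c d where c: "c \<in> B" "a = \<phi> c" and d: "d \<in> B" "b = \<phi> d" by blast
  then have "c \<in> M" "d \<in> M" using B by auto
  then have "a \<otimes> b = \<phi> (c \<otimes> d)" using c d phi_mult by simp
  then show "a \<otimes> b \<in> \<phi> ` B"
    using c d subgroup.m_closed[OF B(1)] by blast
qed

text \<open>This is the power of a coset in the quotient by \<open>M\<close>, with the error term in
  \<open>M\<close> made explicit.\<close>

lemma normal_pow_mult:
  assumes "x \<in> carrier G" "a \<in> M"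
  shows "\<exists>b\<in>M. (x \<otimes> a) [^] (n::nat) = x [^] n \<otimes> b"
proof (induction n)
  case 0
  then show ?case by (auto intro: bexI[of _ \<one>])
next
  case (Suc n)
  then obtain b where b: "b \<in> M" "(x \<otimes> a) [^] n = x [^] n \<otimes> b" by blast
  let ?c = "inv x \<otimes> b \<otimes> x"
  have "?c \<in> M" using assms b inv_op_closed1 by blast
  moreover have "(x \<otimes> a) [^] Suc n = x [^] Suc n \<otimes> (?c \<otimes> a)"
    using assms b by (simp add: m_assoc mult_inv_cancel)
  ultimately show ?case using assms by blast
qed


lemma pow_conj_phi:
  assumes B: "subgroup B G" "B \<subseteq> M" "\<phi> ` B \<subseteq> B" and u: "u \<in> B"
  shows "y [^] (j::nat) \<otimes> u \<otimes> inv (y [^] j) \<otimes> inv u \<in> \<phi> ` B"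
proof (induction j)
  case 0
  have "\<one> \<in> \<phi> ` B" using subgroup.one_closed[OF subgroup_phi_image[OF B(1,2)]] .
  then show ?case using subsetD[OF B(2) u] by simp
next
  case (Suc j)
  have uM: "u \<in> M" using u B by auto
  define w where "w = y [^] j \<otimes> u \<otimes> inv (y [^] j)"
  have wM: "w \<in> M" unfolding w_def using uM inv_op_closed2 by auto
  have c: "w \<otimes> inv u \<in> \<phi> ` B" using Suc unfolding w_def .
  have "w = (w \<otimes> inv u) \<otimes> u" using uM wM by (simp add: m_assoc)
  then have wB: "w \<in> B" using c B u by (metis subgroup.m_closed subsetD)
  have "y [^] Suc j \<otimes> u \<otimes> inv (y [^] Suc j) = y \<otimes> w \<otimes> inv y"
    unfolding w_def nat_pow_Suc2[OF y_closed] using uM by (simp add: conj_conj)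
  then have "y [^] Suc j \<otimes> u \<otimes> inv (y [^] Suc j) \<otimes> inv u = \<phi> w \<otimes> w \<otimes> inv u"
    by (simp only: conj_eq_phi[OF wM])
  also have "\<dots> = \<phi> w \<otimes> (w \<otimes> inv u)"
    using wM uM by (simp add: m_assoc)
  finally show ?case
    using c wB subgroup.m_closed[OF subgroup_phi_image[OF B(1,2)]] by simp
qed

text \<open>Since \<open>M\<close> is abelian, the factor \<open>m\<close> of
  \<open>g = m y^i\<close> drops out: \<open>[h, g]\<close> equals \<open>[y^i, inv h]\<close>,
  which the previous lemma places in the image.\<close>

lemma commutator_subgroup_phi:
  assumes B: "subgroup B G" "B \<subseteq> M" "\<phi> ` B \<subseteq> B"
    and gen: "\<And>g. g \<in> carrier G \<Longrightarrow> \<exists>m\<in>M. \<exists>i::nat. g = m \<otimes> y [^] i"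
  shows "commutator_subgroup G B (carrier G) \<subseteq> \<phi> ` B"
  unfolding commutator_subgroup_def
proof (rule generate_subgroup_incl[OF _ subgroup_phi_image[OF B(1,2)]], safe)
  fix h g assume h: "h \<in> B" and g: "g \<in> carrier G"
  obtain m i where m: "m \<in> M" "g = m \<otimes> y [^] (i::nat)" using gen[OF g] by blast
  have hM: "h \<in> M" using h B by auto
  define w where "w = y [^] i \<otimes> inv h \<otimes> inv (y [^] i)"
  have wM: "w \<in> M" unfolding w_def using hM inv_op_closed2 by auto
  have "h \<otimes> g \<otimes> inv h \<otimes> inv g = h \<otimes> (m \<otimes> w \<otimes> inv m)"
    unfolding w_def m(2) using hM m(1) by (simp add: m_assoc inv_mult_group)
  also have "m \<otimes> w \<otimes> inv m = w"
    using m wM M_comm by (subst conj_eq_iff) auto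
  also have "h \<otimes> w = w \<otimes> inv (inv h)"
    using hM wM M_comm by simp
  also have "\<dots> \<in> \<phi> ` B"
    unfolding w_def using h B pow_conj_phi[OF B] subgroup.m_inv_closed by metis
  finally show "h \<otimes> g \<otimes> inv h \<otimes> inv g \<in> \<phi> ` B" .
qed

section \<open>Iterated images, the lower central series, and fixed points\<close>

definition iter_image where "iter_image i = (\<phi> ^^ i) ` M"

lemma iter_image_simps [simp]:
  "iter_image 0 = M" "iter_image (Suc i) = \<phi> ` iter_image i"
  unfolding iter_image_def by (auto simp: image_image)

lemma iter_image_subgroup: "subgroup (iter_image i) G \<and> iter_image i \<subseteq> M"
proof (induction i)
  case 0
  show ?case using is_subgroup by simp
next
  case (Suc i)
  then show ?case using subgroup_phi_image by auto
qed

lemma iter_image_antimono: "\<phi> ` iter_image i \<subseteq> iter_image i"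
proof (induction i)
  case (Suc i)
  then show ?case by auto
qed auto

lemma iter_image_stable: "\<exists>n. \<phi> ` iter_image n = iter_image n"
proof -
  \<comment> \<open>Choose an image of least cardinality; the next image is contained in it and
    cannot be smaller.\<close>
  obtain n where n: "\<And>i. card (iter_image n) \<le> card (iter_image i)"
    using ex_has_least_nat[of "\<lambda>_. True" 0 "\<lambda>i. card (iter_image i)"] by auto
  have "finite (iter_image n)"
    using iter_image_subgroup finite_M finite_subset by blast
  then have "iter_image (Suc n) = iter_image n"
    using n[of "Suc n"] iter_image_antimono by (intro card_seteq) auto
  then show ?thesis by auto
qed

text \<open>The index is shifted by one because it is the derived subgroup, not \<open>G\<close>,
  that is known to lie in \<open>M\<close>; each further commutator with \<open>G\<close> costs one
  application of \<open>\<phi>\<close>.\<close>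

lemma lower_central_iter_image:
  assumes gen: "\<And>g. g \<in> carrier G \<Longrightarrow> \<exists>m\<in>M. \<exists>i::nat. g = m \<otimes> y [^] i"
    and der: "derived G (carrier G) \<subseteq> M"
  shows "lower_central G (Suc i) \<subseteq> iter_image i"
proof (induction i)
  case 0
  have "{h \<otimes> k \<otimes> inv h \<otimes> inv k |h k. h \<in> carrier G \<and> k \<in> carrier G} = derived_set G (carrier G)"
    by blast
  then show ?case using der by (simp add: commutator_subgroup_def derived_def)
next
  case (Suc i)
  have "lower_central G (Suc (Suc i)) \<subseteq> commutator_subgroup G (iter_image i) (carrier G)"
    using Suc by (subst lower_central.simps(2)) (auto simp: commutator_subgroup_def intro!: mono_generate)
  also have "\<dots> \<subseteq> iter_image (Suc i)"
    using commutator_subgroup_phi[OF _ _ iter_image_antimono gen] iter_image_subgroup by simp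
  finally show ?case .
qed

text \<open>Invariance gives that \<open>[B, G]\<close> lies in \<open>B\<close>, and a conjugate of
  \<open>b\<close> differs from \<open>b\<close> by such a commutator.\<close>

lemma normal_if_phi_invariant:
  assumes B: "subgroup B G" "B \<subseteq> M" "\<phi> ` B \<subseteq> B"
    and gen: "\<And>g. g \<in> carrier G \<Longrightarrow> \<exists>m\<in>M. \<exists>i::nat. g = m \<otimes> y [^] i"
  shows "B \<lhd> G"
proof (unfold normal_inv_iff, intro conjI ballI)
  show "subgroup B G" by fact
  fix g b assume g: "g \<in> carrier G" and b: "b \<in> B"
  have "b \<otimes> g \<otimes> inv b \<otimes> inv g \<in> commutator_subgroup G B (carrier G)"
    unfolding commutator_subgroup_def using g b by (intro generate.incl) auto
  then have c: "b \<otimes> g \<otimes> inv b \<otimes> inv g \<in> B"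
    using commutator_subgroup_phi[OF B gen] B(3) by blast
  have "g \<otimes> b \<otimes> inv g = inv (b \<otimes> g \<otimes> inv b \<otimes> inv g) \<otimes> b"
    using g b B by (simp add: m_assoc inv_mult_group subgroup.mem_carrier)
  then show "g \<otimes> b \<otimes> inv g \<in> B"
    using c b B(1) by (simp add: subgroup.m_closed subgroup.m_inv_closed)
qed

text \<open>As \<open>y^p\<close> lies in the abelian \<open>M\<close>, conjugation by
  \<open>y\<close> has \<open>p\<close>-th iterate the identity on \<open>B\<close>. Its only fixed
  point is \<open>\<one>\<close>, so \<open>card B\<close> is 1 modulo \<open>p\<close>.\<close>

lemma card_coprime_if_fixed_point_free:
  fixes p :: nat
  assumes p: "Factorial_Ring.prime p" and yp: "y [^] p \<in> M"
    and B: "subgroup B G" "B \<subseteq> M" "\<phi> ` B \<subseteq> B"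
    and fpf: "\<And>b. b \<in> B \<Longrightarrow> \<phi> b = \<one> \<Longrightarrow> b = \<one>"
  shows "coprime (card B) p"
proof -
  let ?f = "\<lambda>b. y \<otimes> b \<otimes> inv y"
  have BM: "b \<in> M" if "b \<in> B" for b using that B by auto
  have "[card B = card {b \<in> B. ?f b = b}] (mod p)"
  proof (rule card_fixed_points_cong[OF _ _ p])
    show "finite B" using B finite_M finite_subset by blast
    show "?f b \<in> B" if "b \<in> B" for b
      using that B BM by (simp add: conj_eq_phi image_subset_iff subgroup.m_closed)
    show "(?f ^^ p) b = b" if "b \<in> B" for b
    proof -
      have "y [^] p \<otimes> b \<otimes> inv (y [^] p) = b"
        using BM[OF that] yp M_comm by (subst conj_eq_iff) auto
      then show ?thesis using BM[OF that] by (simp add: conj_funpow)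
    qed
  qed
  also have "{b \<in> B. ?f b = b} = {\<one>}"
  proof -
    have "?f b = b \<longleftrightarrow> b = \<one>" if "b \<in> B" for b
      using fpf[OF that] phi_eq_one_iff[OF BM[OF that]] phi_one by metis
    then show ?thesis using subgroup.one_closed[OF B(1)] by blast
  qed
  finally have "[card B = 1] (mod p)" by simp
  then have "coprime 1 p \<longleftrightarrow> coprime (card B) p"
    using cong_imp_coprime cong_sym by blast
  then show ?thesis by simp
qed

section \<open>The subgroups \<open>\<langle>y\<rangle>B\<close> and the splitting of
  \<open>G\<close>\<close>

lemma subgroup_cyclic_mult:
  assumes B: "B \<lhd> G"
  shows "subgroup (generate G {y} <#> B) G"
  using mult_norm_subgroup[OF B] commut_normal[OF _ B] generate_is_subgroup[of "{y}"] by auto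

lemma mem_cyclic_mult_iff:
  "h \<in> generate G {y} <#> B \<longleftrightarrow> (\<exists>i::nat. \<exists>b\<in>B. h = y [^] i \<otimes> b)"
  unfolding set_mult_def generate_pow_on_finite_carrier[OF finite_carrier y_closed] by blast

text \<open>Since \<open>M\<close> centralizes \<open>B\<close>, an element \<open>m\<close> of \<open>M\<close> normalizes \<open>\<langle>y\<rangle>B\<close> as soon as
  \<open>[y, m]\<close> lies in it. Hence \<open>\<phi>\<close> is injective on \<open>M\<close> modulo a self-normalizing
  \<open>\<langle>y\<rangle>B\<close>, whereas it is nilpotent there when \<open>B\<close> is an iterated image.\<close>

lemma cyclic_mult_normalizer:
  assumes B: "B \<lhd> G" "B \<subseteq> M" and m: "m \<in> M" and phi: "\<phi> m \<in> generate G {y} <#> B"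
  shows "m \<in> normalizer G (generate G {y} <#> B)"
proof (rule normalizerI)
  let ?H = "generate G {y} <#> B"
  show H: "subgroup ?H G" using subgroup_cyclic_mult[OF B(1)] .
  show "finite ?H" using finite_carrier H finite_subset subgroup.subset by blast
  show "m \<in> carrier G" using m by simp
  fix h assume "h \<in> ?H"
  then obtain i b where b: "b \<in> B" "h = y [^] (i::nat) \<otimes> b" unfolding mem_cyclic_mult_iff by blast
  have bM: "b \<in> M" using b B by auto
  have oneB: "\<one> \<in> B" using B normal_imp_subgroup subgroup.one_closed by blast
  have "y = y [^] (1::nat) \<otimes> \<one>" by simp
  then have yH: "y \<in> ?H" unfolding mem_cyclic_mult_iff using oneB by blast
  have "b = y [^] (0::nat) \<otimes> b" using bM by simp
  then have bH: "b \<in> ?H" unfolding mem_cyclic_mult_iff using b by blast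
  have pow: "(m \<otimes> y \<otimes> inv m) [^] i = m \<otimes> y [^] i \<otimes> inv m" for i :: nat
    using m by (induction i) (simp_all add: m_assoc mult_inv_cancel)
  have "m \<otimes> y \<otimes> inv m = inv (\<phi> m) \<otimes> y"
    unfolding \<phi>_def using m by (simp add: m_assoc inv_mult_group)
  then have "m \<otimes> y \<otimes> inv m \<in> ?H"
    using phi yH H by (simp add: subgroup.m_closed subgroup.m_inv_closed)
  then have "(m \<otimes> y \<otimes> inv m) [^] i \<in> ?H"
    using H by (simp add: subgroup_nat_pow_closed)
  moreover have "m \<otimes> b \<otimes> inv m = b"
    using m bM M_comm by (subst conj_eq_iff) auto
  ultimately show "m \<otimes> h \<otimes> inv m \<in> ?H"
    unfolding b(2) using m bM bH H by (simp add: conj_mult pow subgroup.m_closed)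
qed

lemma Yn_structure:
  fixes p :: nat
  assumes p: "Factorial_Ring.prime p" and yp: "y [^] p \<in> M" and ord: "ord y = p ^ k"
    and gen: "\<And>g. g \<in> carrier G \<Longrightarrow> \<exists>m\<in>M. \<exists>i::nat. g = m \<otimes> y [^] i"
    and der: "derived G (carrier G) \<subseteq> M"
    and "Yn G" and "\<not> nilpotent G"
  shows "\<exists>A. A \<lhd> G \<and> generate G {y} \<inter> A = {\<one>} \<and> generate G {y} <#> A = carrier G \<and>
    abelian_set G A \<and> coprime (card A) p \<and> y [^] p \<in> center G \<and>
    (\<forall>a \<in> A. y \<otimes> a \<otimes> inv y = a \<longrightarrow> a = \<one>)"
proof -
  obtain n where n: "\<phi> ` iter_image n = iter_image n" using iter_image_stable by blast
  define A where "A = iter_image n"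
  have A: "subgroup A G" "A \<subseteq> M" "\<phi> ` A = A" unfolding A_def using n iter_image_subgroup by auto
  have nA: "A \<lhd> G" using normal_if_phi_invariant[OF _ _ _ gen] A by simp
  have oneA: "\<one> \<in> A" using A(1) by (rule subgroup.one_closed)
  have finA: "finite A" using A finite_M finite_subset by blast
  \<comment> \<open>On the finite set \<open>A\<close>, surjectivity of \<open>\<phi>\<close> forces
    injectivity, that is, no nontrivial fixed points of \<open>y\<close>.\<close>
  have "inj_on \<phi> A" using A finA by (simp add: eq_card_imp_inj_on)
  then have fpf: "a = \<one>" if "a \<in> A" "\<phi> a = \<one>" for a
    using that oneA phi_one by (metis inj_onD)
  have "A \<noteq> {\<one>}"
  proof
    assume "A = {\<one>}"
    then have "lower_central G (Suc n) \<subseteq> {\<one>}"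
      using lower_central_iter_image[OF gen der, of n] unfolding A_def by simp
    moreover have "\<one> \<in> lower_central G (Suc n)"
      by (simp add: commutator_subgroup_def generate.one)
    ultimately show False using \<open>\<not> nilpotent G\<close> unfolding nilpotent_def by blast
  qed
  then obtain a where a: "a \<in> A" "a \<noteq> \<one>" using oneA by blast
  let ?H = "generate G {y} <#> A"
  have H: "subgroup ?H G" using subgroup_cyclic_mult[OF nA] .
  have "y = y [^] (1::nat) \<otimes> \<one>" "a = y [^] (0::nat) \<otimes> a" using a A by auto
  then have yH: "y \<in> ?H" and aH: "a \<in> ?H" unfolding mem_cyclic_mult_iff using a oneA by blast+
  have AH: "A \<subseteq> ?H"
  proof
    fix b assume b: "b \<in> A"
    then have "b = y [^] (0::nat) \<otimes> b" using A by auto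
    then show "b \<in> ?H" unfolding mem_cyclic_mult_iff using b by blast
  qed
  have "\<not> abelian_set G ?H"
  proof
    assume "abelian_set G ?H"
    then have "y \<otimes> a = a \<otimes> y" using yH aH by (simp add: abelian_set_def)
    then have "\<phi> a = \<one>" using a A phi_eq_one_iff conj_eq_iff by auto
    then show False using fpf a by blast
  qed
  then have norm: "normalizer G ?H = ?H" using \<open>Yn G\<close> H unfolding Yn_def by blast
  have step: "m \<in> ?H" if "m \<in> M" "\<phi> m \<in> ?H" for m
    using cyclic_mult_normalizer[OF nA A(2)] that norm by blast
  \<comment> \<open>Pull membership back through \<open>i\<close> applications of
    \<open>\<phi>\<close>; for \<open>i = n\<close> the start is automatic, because the
    \<open>n\<close>-th image of \<open>M\<close> is \<open>A\<close>.\<close>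
  have "m \<in> ?H" if "m \<in> M" "(\<phi> ^^ i) m \<in> ?H" for m i
    using that
  proof (induction i arbitrary: m)
    case (Suc i)
    then have "\<phi> m \<in> ?H" by (simp add: funpow_swap1)
    then show ?case using step Suc by blast
  qed simp
  moreover have "(\<phi> ^^ n) m \<in> ?H" if "m \<in> M" for m
    using that AH unfolding A_def iter_image_def by blast
  ultimately have MH: "M \<subseteq> ?H" by blast
  have "g \<in> ?H" if g: "g \<in> carrier G" for g
  proof -
    obtain m i where "m \<in> M" "g = m \<otimes> y [^] (i::nat)" using gen[OF g] by blast
    then show ?thesis using MH yH H by (simp add: subgroup.m_closed subgroup_nat_pow_closed subsetD)
  qed
  then have 2: "?H = carrier G" using subgroup.subset[OF H] by blast
  \<comment> \<open>An element of the intersection is a power of \<open>y\<close>, hence commutes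
    with \<open>y\<close> and is a fixed point in \<open>A\<close>.\<close>
  have "b = \<one>" if b: "b \<in> generate G {y}" "b \<in> A" for b
  proof -
    obtain i where "b = y [^] (i::nat)"
      using b generate_pow_on_finite_carrier[OF finite_carrier y_closed] by blast
    then have "y \<otimes> b = b \<otimes> y" by (metis nat_pow_Suc nat_pow_Suc2 y_closed)
    then have "\<phi> b = \<one>" using b A phi_eq_one_iff conj_eq_iff by auto
    then show "b = \<one>" using fpf b by blast
  qed
  then have 1: "generate G {y} \<inter> A = {\<one>}" using oneA generate.one by blast
  have 3: "abelian_set G A" using A M_comm unfolding abelian_set_def by blast
  have 4: "coprime (card A) p"
    using card_coprime_if_fixed_point_free[OF p yp] A fpf by simp
  \<comment> \<open>\<open>y^p\<close> commutes with \<open>M\<close>, being in it, and with the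
    powers of \<open>y\<close>; together these give all of \<open>G\<close>.\<close>
  have "y [^] p \<otimes> g = g \<otimes> y [^] p" if g: "g \<in> carrier G" for g
  proof -
    obtain m i where m: "m \<in> M" "g = m \<otimes> y [^] (i::nat)" using gen[OF g] by blast
    have "y [^] p \<otimes> g = m \<otimes> (y [^] p \<otimes> y [^] i)"
      unfolding m using M_comm[OF yp m(1)] m(1) by (simp flip: m_assoc)
    also have "\<dots> = m \<otimes> (y [^] i \<otimes> y [^] p)" by (simp add: nat_pow_mult add.commute)
    finally show ?thesis unfolding m using m(1) by (simp add: m_assoc)
  qed
  then have 5: "y [^] p \<in> center G" by (simp add: center_def)
  have 6: "\<forall>a\<in>A. y \<otimes> a \<otimes> inv y = a \<longrightarrow> a = \<one>"
    using fpf A phi_eq_one_iff by blast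
  show ?thesis using nA 1 2 3 4 5 6 by blast
qed

section \<open>The converse: fixed-point-free action makes non-abelian subgroups
  self-normalizing\<close>

lemma fixed_point_free_imp_Yn:
  fixes p :: nat
  assumes p: "Factorial_Ring.prime p" and ord: "ord y = p ^ k"
    and gen: "generate G {y} <#> M = carrier G"
    and yp: "y [^] p \<in> center G"
    and fpf: "\<And>a. a \<in> M \<Longrightarrow> y \<otimes> a \<otimes> inv y = a \<Longrightarrow> a = \<one>"
  shows "Yn G"
  unfolding Yn_def
proof (intro allI impI, elim conjE)
  fix H assume H: "subgroup H G" and nab: "\<not> abelian_set G H"
  have HG: "h \<in> carrier G" if "h \<in> H" for h using that H subgroup.mem_carrier by metis
  have decomp: "\<exists>i::nat. \<exists>b\<in>M. g = y [^] i \<otimes> b" if "g \<in> carrier G" for g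
    using that mem_cyclic_mult_iff[of g M] gen by simp
  obtain h i b where h: "h \<in> H" "h = y [^] (i::nat) \<otimes> b" "b \<in> M" "\<not> p dvd i"
  proof (rule ccontr)
    note found = that
    assume "\<not> thesis"
    then have no: "p dvd i" if "y [^] (i::nat) \<otimes> b \<in> H" "b \<in> M" for i b
      using that found by blast
    \<comment> \<open>If only multiples of \<open>p\<close> occur as exponents, the
      \<open>y\<close>-parts are powers of the central \<open>y^p\<close>. Then \<open>H\<close>
      lies in the product of the center and \<open>M\<close>, which is abelian.\<close>
    have cen: "\<exists>z\<in>center G. \<exists>b\<in>M. g = z \<otimes> b" if g: "g \<in> H" for g
    proof -
      obtain i b where b: "b \<in> M" "g = y [^] (i::nat) \<otimes> b" using decomp HG g by blast
      then obtain q where q: "i = p * q" using no g by blast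
      have "y [^] i \<otimes> g = g \<otimes> y [^] i" if "g \<in> carrier G" for g
      proof -
        have "y [^] p \<otimes> g = g \<otimes> y [^] p" using yp that by (simp add: center_def)
        then have "(y [^] p) [^] q \<otimes> g = g \<otimes> (y [^] p) [^] q"
          by (rule group_commutes_pow) (use that in auto)
        then show ?thesis using q by (simp add: nat_pow_pow)
      qed
      then have "y [^] i \<in> center G" by (simp add: center_def)
      then show ?thesis using b by blast
    qed
    have "g \<otimes> h = h \<otimes> g" if gh: "g \<in> H" "h \<in> H" for g h
    proof -
      obtain z b where z: "z \<in> center G" "b \<in> M" "g = z \<otimes> b" using cen gh by blast
      obtain w c where w: "w \<in> center G" "c \<in> M" "h = w \<otimes> c" using cen gh by blast
      have G: "z \<in> carrier G" "w \<in> carrier G" using z w by (auto simp: center_def)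
      have "g \<otimes> h = z \<otimes> ((b \<otimes> w) \<otimes> c)" using z w G by (simp add: m_assoc)
      also have "b \<otimes> w = w \<otimes> b" using w z by (simp add: center_def)
      also have "z \<otimes> ((w \<otimes> b) \<otimes> c) = (z \<otimes> w) \<otimes> (b \<otimes> c)" using z w G by (simp add: m_assoc)
      also have "z \<otimes> w = w \<otimes> z" using z G by (simp add: center_def)
      also have "b \<otimes> c = c \<otimes> b" using M_comm z w by blast
      also have "(w \<otimes> z) \<otimes> (c \<otimes> b) = w \<otimes> ((z \<otimes> c) \<otimes> b)" using z w G by (simp add: m_assoc)
      also have "z \<otimes> c = c \<otimes> z" using z w by (simp add: center_def)
      also have "w \<otimes> ((c \<otimes> z) \<otimes> b) = h \<otimes> g" using z w G by (simp add: m_assoc)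
      finally show ?thesis .
    qed
    then show False using nab unfolding abelian_set_def by blast
  qed
  have "i \<noteq> 0" using h(4) by (metis dvd_0_right)
  have "coprime i p" using h(4) p prime_imp_coprime coprime_commute by blast
  then have "coprime i (p ^ k)" by simp
  \<comment> \<open>The exponent \<open>u\<close> inverts \<open>i\<close> modulo the order of
    \<open>y\<close>, so \<open>h^u\<close> has \<open>y\<close>-part exactly
    \<open>y\<close>.\<close>
  then obtain u v where uv: "i * u = p ^ k * v + 1"
    using bezout_nat[OF \<open>i \<noteq> 0\<close>, of "p ^ k"] by auto
  have "y [^] (p ^ k) = \<one>" using ord pow_ord_eq_1[OF y_closed] by simp
  then have "y [^] (p ^ k * v) = \<one>" by (simp flip: nat_pow_pow)
  then have yiu: "(y [^] i) [^] u = y" unfolding nat_pow_pow[OF y_closed] uv by simp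
  obtain c where c: "c \<in> M" "h [^] u = y \<otimes> c"
    using normal_pow_mult[of "y [^] i" b u] h(2,3) yiu by auto
  define w where "w = y \<otimes> c"
  have wH: "w \<in> H" using c h(1) subgroup_nat_pow_closed[OF H] by (metis w_def)
  \<comment> \<open>The theory of \<open>\<phi>\<close> is now used for \<open>w\<close> in place of
    \<open>y\<close>. As \<open>c\<close> centralizes \<open>M\<close>, both act on \<open>M\<close>
    alike, so \<open>w\<close> is fixed point free too and has the advantage of lying in
    \<open>H\<close>.\<close>
  interpret w: abelian_normal_conj M G w
    by unfold_locales (use finite_carrier abelian HG wH in auto)
  have wconj: "w \<otimes> a \<otimes> inv w = y \<otimes> a \<otimes> inv y" if a: "a \<in> M" for a
  proof -
    have "c \<otimes> a \<otimes> inv c = a" using a c M_comm by (subst conj_eq_iff) auto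
    then show ?thesis
      unfolding w_def using conj_conj[of y c a] a c by simp
  qed
  have ker: "a = \<one>" if "a \<in> M" "w.\<phi> a = \<one>" for a
    using that w.phi_eq_one_iff wconj fpf by simp
  have inj: "inj_on w.\<phi> M" using w.phi_inj_onI[OF is_subgroup] ker by blast
  have "w.\<phi> ` (H \<inter> M) \<subseteq> H \<inter> M"
  proof (rule image_subsetI)
    fix a assume a: "a \<in> H \<inter> M"
    then have "w.\<phi> a \<in> H"
      unfolding w.\<phi>_def using wH H by (simp add: subgroup.m_closed subgroup.m_inv_closed)
    then show "w.\<phi> a \<in> H \<inter> M" using a w.phi_closed by blast
  qed
  then have surj: "w.\<phi> ` (H \<inter> M) = H \<inter> M"
    using inj finite_M by (intro endo_inj_surj) (auto intro: inj_on_subset)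
  have "g \<in> H" if g: "g \<in> normalizer G H" for g
  proof -
    have gG: "g \<in> carrier G" using normalizerD[OF H g wH] by simp
    obtain j b where b: "b \<in> M" "g = y [^] (j::nat) \<otimes> b" using decomp[OF gG] by blast
    obtain c' where c': "c' \<in> M" "w [^] j = y [^] j \<otimes> c'"
      using normal_pow_mult[OF y_closed c(1), of j] unfolding w_def by blast
    \<comment> \<open>\<open>g\<close> and \<open>w^j\<close> agree modulo \<open>M\<close>. Since
      \<open>w^j\<close> lies in \<open>H\<close>, the question reduces to the factor
      \<open>d\<close> in \<open>M\<close>, which also normalizes \<open>H\<close>.\<close>
    define d where "d = inv c' \<otimes> b"
    have dM: "d \<in> M" unfolding d_def using c' b by simp
    have gd: "g = w [^] j \<otimes> d"
      unfolding d_def c' b using c' b by (simp add: m_assoc mult_inv_cancel)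
    have wj: "w [^] j \<in> H" using wH subgroup_nat_pow_closed[OF H] by blast
    have N: "subgroup (normalizer G H) G"
      using normalizer_imp_subgroup subgroup.subset[OF H] by blast
    have "d = inv (w [^] j) \<otimes> g" unfolding gd using dM by (simp add: mult_inv_cancel)
    then have "d \<in> normalizer G H"
      using g wj subset_normalizer[OF H] subgroup.m_closed[OF N] subgroup.m_inv_closed[OF N] by auto
    then have "d \<otimes> w \<otimes> inv d \<in> H" using normalizerD(2)[OF H _ wH] by blast
    then have "w \<otimes> inv (d \<otimes> w \<otimes> inv d) \<in> H"
      using wH H by (simp add: subgroup.m_closed subgroup.m_inv_closed)
    moreover have "w \<otimes> inv (d \<otimes> w \<otimes> inv d) = w.\<phi> d"
      unfolding w.\<phi>_def using dM by (simp add: m_assoc inv_mult_group)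
    \<comment> \<open>\<open>[w, d]\<close> lies in both \<open>H\<close> and \<open>M\<close>, so
      it is also \<open>[w, e]\<close> for some \<open>e\<close> in \<open>H \<inter> M\<close>;
      injectivity on \<open>M\<close> gives \<open>d = e\<close>.\<close>
    ultimately have "w.\<phi> d \<in> w.\<phi> ` (H \<inter> M)" using surj dM w.phi_closed by simp
    then have "d \<in> H" using inj dM by (auto dest: inj_onD)
    then show "g \<in> H" unfolding gd using wj subgroup.m_closed[OF H] by blast
  qed
  then show "normalizer G H = H" using subset_normalizer[OF H] by blast
qed

end

section \<open>Both directions assembled\<close>

lemma (in group) Yn_imp_split:
  assumes fin: "finite (carrier G)" and sol: "solvable G" and nil: "\<not> nilpotent G" and "Yn G"
  shows "\<exists>x A p. Factorial_Ring.prime (p::nat) \<and> x \<in> carrier G \<and> A \<lhd> G \<and>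
       generate G {x} \<inter> A = {\<one>} \<and> generate G {x} <#> A = carrier G \<and>
       (\<exists>k::nat. card (generate G {x}) = p ^ k) \<and>
       abelian_set G A \<and> coprime (card A) p \<and> x [^] p \<in> center G \<and>
       (\<forall>a \<in> A. x \<otimes> a \<otimes> inv x = a \<longrightarrow> a = \<one>)"
proof -
  have "carrier G \<noteq> {\<one>}"
    using nil unfolding nilpotent_def by (metis lower_central.simps(1))
  then obtain M where M: "subgroup M G" "M \<noteq> carrier G" and der: "derived G (carrier G) \<subseteq> M"
    and max: "\<And>H. subgroup H G \<Longrightarrow> M \<subset> H \<Longrightarrow> H = carrier G"
    using ex_maximal_subgroup_above[OF fin derived_is_subgroup[OF order_refl]]
      solvable_derived_proper[OF sol] by blast
  have nM: "M \<lhd> G" using normal_if_derived_subset[OF M(1) der] .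
  have "g \<in> normalizer G M" if "g \<in> carrier G" for g
    using that M nM fin normalizerI[OF M(1)] normal.inv_op_closed2[OF nM]
      finite_subset subgroup.subset by metis
  then have "normalizer G M \<noteq> M" using M subgroup.subset by blast
  then have abM: "abelian_set G M" using \<open>Yn G\<close> M(1) unfolding Yn_def by blast
  obtain p k y where p: "Factorial_Ring.prime (p::nat)" and y: "y \<in> carrier G" "y \<notin> M" "y [^] p \<in> M"
    "ord y = p ^ k" using ex_primepow_order_outside[OF fin M] by blast
  interpret abelian_normal_conj M G y
    by (intro abelian_normal_conj.intro abelian_normal_conj_axioms.intro nM fin abM y(1))
  have gen: "\<exists>m\<in>M. \<exists>i::nat. g = m \<otimes> y [^] i" if g: "g \<in> carrier G" for g
  proof -
    let ?H = "generate G {y} <#> M"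
    have "y = y [^] (1::nat) \<otimes> \<one>" using y by simp
    then have "y \<in> ?H" unfolding mem_cyclic_mult_iff using one_closed by blast
    moreover have "M \<subseteq> ?H"
    proof
      fix m assume m: "m \<in> M"
      then have "m = y [^] (0::nat) \<otimes> m" by simp
      then show "m \<in> ?H" unfolding mem_cyclic_mult_iff using m by blast
    qed
    \<comment> \<open>\<open>\<langle>y\<rangle>M\<close> properly contains the maximal subgroup
      \<open>M\<close>, because \<open>y\<close> is outside \<open>M\<close>.\<close>
    ultimately have "?H = carrier G" using max[OF subgroup_cyclic_mult[OF nM]] y by blast
    then have "g \<in> M <#> generate G {y}"
      using g commut_normal[OF generate_is_subgroup nM, of "{y}"] y by simp
    then show ?thesis
      unfolding set_mult_def generate_pow_on_finite_carrier[OF fin y(1)] by blast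
  qed
  show ?thesis
    using Yn_structure[OF p y(3,4) gen der \<open>Yn G\<close> nil] p y(1,4) generate_pow_card[OF y(1)] by metis
qed

theorem theorem2p13:
  fixes G :: "('a, 'b) monoid_scheme"
  assumes "group G" and "finite (carrier G)" and "solvable G" and "\<not> nilpotent G"
  shows "Yn G \<longleftrightarrow>
    (\<exists>x A p. Factorial_Ring.prime (p::nat) \<and> x \<in> carrier G \<and> A \<lhd> G \<and>
       generate G {x} \<inter> A = {\<one>\<^bsub>G\<^esub>} \<and>
       generate G {x} <#>\<^bsub>G\<^esub> A = carrier G \<and>
       (\<exists>k::nat. card (generate G {x}) = p ^ k) \<and>
       abelian_set G A \<and> coprime (card A) p \<and>
       x [^]\<^bsub>G\<^esub> p \<in> center G \<and>
       (\<forall>a \<in> A. x \<otimes>\<^bsub>G\<^esub> a \<otimes>\<^bsub>G\<^esub> inv\<^bsub>G\<^esub> x = a \<longrightarrow> a = \<one>\<^bsub>G\<^esub>))"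
  (is "_ \<longleftrightarrow> ?R")
proof
  interpret group G by fact
  show "Yn G \<Longrightarrow> ?R" using Yn_imp_split assms by blast
  show "Yn G" if R: ?R
  proof -
    obtain x A p k where *: "Factorial_Ring.prime (p::nat)" "x \<in> carrier G" "A \<lhd> G"
      "generate G {x} <#>\<^bsub>G\<^esub> A = carrier G" "card (generate G {x}) = p ^ k"
      "abelian_set G A" "x [^]\<^bsub>G\<^esub> p \<in> center G" "\<forall>a \<in> A. x \<otimes>\<^bsub>G\<^esub> a \<otimes>\<^bsub>G\<^esub> inv\<^bsub>G\<^esub> x = a \<longrightarrow> a = \<one>\<^bsub>G\<^esub>"
      using R by blast
    \<comment> \<open>In this direction the given factor \<open>A\<close> itself takes the place of
      \<open>M\<close>.\<close>
    interpret abelian_normal_conj A G x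
      by (intro abelian_normal_conj.intro abelian_normal_conj_axioms.intro * assms)
    show ?thesis
      using fixed_point_free_imp_Yn[of p k] * generate_pow_card[of x] by simp
  qed
qed

end
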